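(* Let $a,b\in\mathbb R$ be such that $d(a-jh,b-ih)\neq0$ for $0\le i\le j\le n-1$, and let $G\in\pi_n(\gamma_1,\gamma_2)$ with $h$--$\gamma$ blossom $g$. Set $$Q_i^0=g\big(\Gamma(a-ih),\ldots,\Gamma(a-(n-1)h),\Gamma(b),\Gamma(b-h),\ldots,\Gamma(b-(i-1)h);h\big),\quad i=0,\ldots,n,$$ and define recursively, for $u_1,\ldots,u_n\in\mathbb R$, the multilinear functions $$Q_i^{k+1}(\Gamma(u_1),\ldots,\Gamma(u_{k+1});h)=\frac{d(u_{k+1},b-ih)}{d(a-(i+k)h,b-ih)}\,Q_i^k(\Gamma(u_1),\ldots,\Gamma(u_k);h)+\frac{d(a-(i+k)h,u_{k+1})}{d(a-(i+k)h,b-ih)}\,Q_{i+1}^k(\Gamma(u_1),\ldots,\Gamma(u_k);h)$$ for $i=0,\ldots,n-k-1$ and $k=0,\ldots,n-1$. Then $$Q_i^k(\Gamma(u_1),\ldots,\Gamma(u_k);h)=g\big(\Gamma(a-(k+i)h),\ldots,\Gamma(a-(n-1)h),\Gamma(b),\Gamma(b-h),\ldots,\Gamma(b-(i-1)h),\Gamma(u_1),\ldots,\Gamma(u_k);h\big)$$ for $i=0,\ldots,n-k$ and $k=0,\ldots,n$. In particular, $Q_0^n(\Gamma(u_1),\ldots,\Gamma(u_n);h)=g(\Gamma(u_1),\ldots,\Gamma(u_n);h)$.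
   Context: Let $n\ge 1$ be an integer and $h\in\mathbb R$ fixed. Let $\gamma_1,\gamma_2:\mathbb R\to\mathbb R$ be continuous, linearly independent functions, and write $\Gamma(t)=(\gamma_1(t),\gamma_2(t))$. They are assumed translation invariant: for every $s\in\mathbb R$ there is an invertible $2\times2$ matrix $C(s)$ with $\begin{pmatrix}\gamma_1(x-s)\\ \gamma_2(x-s)\end{pmatrix}=C(s)\begin{pmatrix}\gamma_1(x)\\ \gamma_2(x)\end{pmatrix}$ for all $x$. Put $\pi_n(\gamma_1,\gamma_2)=\mathrm{span}\{\gamma_1^{n-k}\gamma_2^{k}\}_{k=0}^n$ and $d(u,v)=\gamma_1(u)\gamma_2(v)-\gamma_2(u)\gamma_1(v)$. For $0\le k\le n$ put $G_{n,k}(t;h)=\sum_{I\subseteq\{1,\ldots,n\},\,|I|=k}\ \prod_{i\in I}\gamma_1(t-(i-1)h)\prod_{i\in\{1,\ldots,n\}\setminus I}\gamma_2(t-(i-1)h)$. Standing assumption: $h$ is such that the functions $t\mapsto G_{n,k}(t;h)$, $k=0,\ldots,n$, are linearly independent. The $h$--$\gamma$ blossom of $G\in\pi_n(\gamma_1,\gamma_2)$ is the (unique, existing) function $g(\cdot\,;h):(\mathbb R^2)^n\to\mathbb R$ that is symmetric, linear in each of its $n$ arguments in $\mathbb R^2$, and satisfies $g(\Gamma(t),\Gamma(t-h),\ldots,\Gamma(t-(n-1)h);h)=G(t)$ for all $t$. Argument lists of the form $\Gamma(a-mh),\ldots,\Gamma(a-(n-1)h)$ with $m=n$, or $\Gamma(b),\ldots,\Gamma(b-(i-1)h)$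 with $i=0$, are empty. *)

theory Defs
  imports "HOL-Analysis.Analysis" "HOL-Library.Multiset"
begin

definition curve :: "(real \<Rightarrow> real) \<Rightarrow> (real \<Rightarrow> real) \<Rightarrow> real \<Rightarrow> real^2" where
  "curve \<gamma>1 \<gamma>2 t = vector [\<gamma>1 t, \<gamma>2 t]"

text \<open>Linear independence of a family of real functions indexed by a finite set; as a statement
  about families (not sets) it also excludes repeated members.\<close>

definition indep_functions :: "'i set \<Rightarrow> ('i \<Rightarrow> real \<Rightarrow> real) \<Rightarrow> bool" where
  "indep_functions I f \<longleftrightarrow>
     (\<forall>c. (\<forall>t. (\<Sum>i\<in>I. c i * f i t) = 0) \<longrightarrow> (\<forall>i\<in>I. c i = 0))"

definition translation_invariant :: "(real \<Rightarrow> real) \<Rightarrow> (real \<Rightarrow> real) \<Rightarrow> bool" where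
  "translation_invariant \<gamma>1 \<gamma>2 \<longleftrightarrow>
     (\<forall>s. \<exists>C :: real^2^2. invertible C \<and>
        (\<forall>x. curve \<gamma>1 \<gamma>2 (x - s) = C *v curve \<gamma>1 \<gamma>2 x))"

definition pi_space :: "nat \<Rightarrow> (real \<Rightarrow> real) \<Rightarrow> (real \<Rightarrow> real) \<Rightarrow> (real \<Rightarrow> real) set" where
  "pi_space n \<gamma>1 \<gamma>2 = {G. \<exists>c :: nat \<Rightarrow> real. \<forall>t. G t = (\<Sum>k\<le>n. c k * (\<gamma>1 t ^ (n - k) * \<gamma>2 t ^ k))}"

definition dfun :: "(real \<Rightarrow> real) \<Rightarrow> (real \<Rightarrow> real) \<Rightarrow> real \<Rightarrow> real \<Rightarrow> real" where
  "dfun \<gamma>1 \<gamma>2 u v = \<gamma>1 u * \<gamma>2 v - \<gamma>2 u * \<gamma>1 v"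

definition Gfun :: "(real \<Rightarrow> real) \<Rightarrow> (real \<Rightarrow> real) \<Rightarrow> real \<Rightarrow> nat \<Rightarrow> nat \<Rightarrow> real \<Rightarrow> real" where
  "Gfun \<gamma>1 \<gamma>2 h n k t =
     (\<Sum>I\<in>{I. I \<subseteq> {1..n} \<and> card I = k}.
        (\<Prod>i\<in>I. \<gamma>1 (t - (real i - 1) * h)) * (\<Prod>i\<in>{1..n} - I. \<gamma>2 (t - (real i - 1) * h)))"

text \<open>A function on the \<open>n\<close>-th power of the plane is represented by a function on lists of which
  only the values on lists of length \<open>n\<close> matter.\<close>

definition symmetric_args :: "nat \<Rightarrow> ('a list \<Rightarrow> real) \<Rightarrow> bool" where
  "symmetric_args n f \<longleftrightarrow>
     (\<forall>vs ws. length vs = n \<longrightarrow> mset ws = mset vs \<longrightarrow> f ws = f vs)"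

definition multilinear :: "nat \<Rightarrow> ('a::real_vector list \<Rightarrow> real) \<Rightarrow> bool" where
  "multilinear n f \<longleftrightarrow>
     (\<forall>vs. length vs = n \<longrightarrow> (\<forall>j<n. linear (\<lambda>x. f (vs[j := x]))))"

definition shifts :: "(real \<Rightarrow> real) \<Rightarrow> (real \<Rightarrow> real) \<Rightarrow> real \<Rightarrow> real \<Rightarrow> nat \<Rightarrow> nat \<Rightarrow> (real^2) list" where
  "shifts \<gamma>1 \<gamma>2 h x p q = map (\<lambda>m. curve \<gamma>1 \<gamma>2 (x - real m * h)) [p..<q]"

definition is_blossom ::
  "(real \<Rightarrow> real) \<Rightarrow> (real \<Rightarrow> real) \<Rightarrow> real \<Rightarrow> nat \<Rightarrow> (real \<Rightarrow> real) \<Rightarrow> ((real^2) list \<Rightarrow> real) \<Rightarrow> bool" where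
  "is_blossom \<gamma>1 \<gamma>2 h n G g \<longleftrightarrow>
     symmetric_args n g \<and> multilinear n g \<and>
     (\<forall>t. g (shifts \<gamma>1 \<gamma>2 h t 0 n) = G t)"

text \<open>The function \<open>Qfun \<gamma>1 \<gamma>2 h n a b g k i\<close> is \<open>Q\<close> with upper index \<open>k\<close> and lower index \<open>i\<close>, as a
  function of \<open>k\<close> vectors. The coefficients involving the last argument are linear extensions of
  \<open>dfun\<close> from the curve to the plane, by \<open>dfun_eq_det\<close> below; the recursion for arguments on
  the curve is \<open>Qfun_Suc_curve\<close>.\<close>

primrec Qfun ::
  "(real \<Rightarrow> real) \<Rightarrow> (real \<Rightarrow> real) \<Rightarrow> real \<Rightarrow> nat \<Rightarrow> real \<Rightarrow> real \<Rightarrow> ((real^2) list \<Rightarrow> real) \<Rightarrow>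
     nat \<Rightarrow> nat \<Rightarrow> (real^2) list \<Rightarrow> real" where
  "Qfun \<gamma>1 \<gamma>2 h n a b g 0 i vs = g (shifts \<gamma>1 \<gamma>2 h a i n @ shifts \<gamma>1 \<gamma>2 h b 0 i)"
| "Qfun \<gamma>1 \<gamma>2 h n a b g (Suc k) i vs =
     det (vector [last vs, curve \<gamma>1 \<gamma>2 (b - real i * h)] :: real^2^2)
       / dfun \<gamma>1 \<gamma>2 (a - real (i + k) * h) (b - real i * h)
       * Qfun \<gamma>1 \<gamma>2 h n a b g k i (butlast vs)
   + det (vector [curve \<gamma>1 \<gamma>2 (a - real (i + k) * h), last vs] :: real^2^2)
       / dfun \<gamma>1 \<gamma>2 (a - real (i + k) * h) (b - real i * h)
       * Qfun \<gamma>1 \<gamma>2 h n a b g k (Suc i) (butlast vs)"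

lemma dfun_eq_det:
  "dfun \<gamma>1 \<gamma>2 u v = det (vector [curve \<gamma>1 \<gamma>2 u, curve \<gamma>1 \<gamma>2 v] :: real^2^2)"
  by (simp add: dfun_def curve_def det_2)

lemma Qfun_Suc_curve:
  "Qfun \<gamma>1 \<gamma>2 h n a b g (Suc k) i (map (curve \<gamma>1 \<gamma>2) (us @ [u])) =
     dfun \<gamma>1 \<gamma>2 u (b - real i * h) / dfun \<gamma>1 \<gamma>2 (a - real (i + k) * h) (b - real i * h)
       * Qfun \<gamma>1 \<gamma>2 h n a b g k i (map (curve \<gamma>1 \<gamma>2) us)
   + dfun \<gamma>1 \<gamma>2 (a - real (i + k) * h) u / dfun \<gamma>1 \<gamma>2 (a - real (i + k) * h) (b - real i * h)
       * Qfun \<gamma>1 \<gamma>2 h n a b g k (Suc i) (map (curve \<gamma>1 \<gamma>2) us)"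
  by (simp add: dfun_eq_det butlast_append)

lemma multilinear_Qfun: "multilinear k (Qfun \<gamma>1 \<gamma>2 h n a b g k i)"
proof (induction k arbitrary: i)
  case 0
  show ?case by (simp add: multilinear_def)
next
  case (Suc k)
  show ?case
    unfolding multilinear_def
  proof (intro allI impI)
    fix vs :: "(real^2) list" and j
    assume len: "length vs = Suc k" and j: "j < Suc k"
    let ?Q = "Qfun \<gamma>1 \<gamma>2 h n a b g"
    show "linear (\<lambda>x. ?Q (Suc k) i (vs[j := x]))"
    proof (cases "j = k")
      case True
      then have "last (vs[j := x]) = x" "butlast (vs[j := x]) = butlast vs" for x
        using len by (auto simp: last_list_update butlast_list_update simp flip: length_0_conv)
      then show ?thesis
        by (intro linearI) (simp_all add: det_2 algebra_simps add_divide_distrib diff_divide_distrib)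
    next
      case False
      with j have jk: "j < k" by simp
      have *: "last (vs[j := x]) = last vs" "butlast (vs[j := x]) = (butlast vs)[j := x]" for x
        using len jk
        by (auto simp: last_list_update butlast_list_update simp flip: length_0_conv)
      have "linear (\<lambda>x. ?Q k i' ((butlast vs)[j := x]))" for i'
        using Suc.IH[of i'] len jk by (simp add: multilinear_def)
      note lin = this[of i] this[of "Suc i"]
      show ?thesis
        by (intro linearI)
          (simp_all add: * linear_add[OF lin(1)] linear_add[OF lin(2)]
            linear_cmul[OF lin(1)] linear_cmul[OF lin(2)] algebra_simps
            add_divide_distrib)
    qed
  qed
qed

end

theory Submission
  imports Defs
begin

text \<open>Each step of the recursion replaces one argument of the blossom: by Cramer's rule the new
  vector is the combination of \<open>\<Gamma>(a - (i+k)h)\<close> and \<open>\<Gamma>(b - ih)\<close> with the coefficients of the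
  recursion, while symmetry and linearity of \<open>g\<close> in one argument turn this combination into the
  same combination of blossom values.\<close>

text \<open>Multiplied by \<open>D\<close>, the claim is a polynomial identity in the coordinates,
  valid for all \<open>A\<close>, \<open>B\<close> and \<open>u\<close>; a nonzero \<open>D\<close>
  then allows division.\<close>

lemma cramer_vec2:
  fixes A B u :: "real^2"
  defines "D \<equiv> det (vector [A, B] :: real^2^2)"
  assumes "D \<noteq> 0"
  shows "u = (det (vector [u, B] :: real^2^2) / D) *\<^sub>R A + (det (vector [A, u] :: real^2^2) / D) *\<^sub>R B"
proof -
  have "D *\<^sub>R u = det (vector [u, B] :: real^2^2) *\<^sub>R A + det (vector [A, u] :: real^2^2) *\<^sub>R B"
    by (simp add: D_def vec_eq_iff forall_2 det_2 algebra_simps)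
  then have "(1 / D) *\<^sub>R (D *\<^sub>R u)
      = (1 / D) *\<^sub>R (det (vector [u, B] :: real^2^2) *\<^sub>R A + det (vector [A, u] :: real^2^2) *\<^sub>R B)"
    by simp
  with \<open>D \<noteq> 0\<close> show ?thesis
    by (simp add: scaleR_add_right)
qed

text \<open>This is the form in which Cramer's rule enters the recursion: \<open>f\<close> will be
  the blossom as a function of its first argument, the others being frozen.\<close>

lemma linear_cramer:
  fixes A B u :: "real^2" and f :: "real^2 \<Rightarrow> real"
  assumes "linear f" and "det (vector [A, B] :: real^2^2) \<noteq> 0"
  shows "f u = det (vector [u, B] :: real^2^2) / det (vector [A, B] :: real^2^2) * f A
             + det (vector [A, u] :: real^2^2) / det (vector [A, B] :: real^2^2) * f B"
  using arg_cong[OF cramer_vec2[OF assms(2), of u], of f]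
  by (simp add: linear_add[OF assms(1)] linear_cmul[OF assms(1)])

lemma multilinear_Cons:
  assumes "multilinear (Suc m) f" and "length vs = m"
  shows "linear (\<lambda>x. f (x # vs))"
proof -
  \<comment> \<open>The head \<open>0\<close> is a placeholder that the update overwrites.\<close>
  have "linear (\<lambda>x. f ((0 # vs)[0 := x]))"
    using assms unfolding multilinear_def by (metis length_Cons zero_less_Suc)
  then show ?thesis by simp
qed

lemma length_shifts [simp]: "length (shifts \<gamma>1 \<gamma>2 h x p q) = q - p"
  by (simp add: shifts_def)

lemma shifts_empty [simp]: "q \<le> p \<Longrightarrow> shifts \<gamma>1 \<gamma>2 h x p q = []"
  by (simp add: shifts_def)

lemma shifts_Cons:
  "p < q \<Longrightarrow> shifts \<gamma>1 \<gamma>2 h x p q = curve \<gamma>1 \<gamma>2 (x - real p * h) # shifts \<gamma>1 \<gamma>2 h x (Suc p) q"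
  by (simp add: shifts_def upt_conv_Cons)

lemma shifts_snoc:
  "p \<le> q \<Longrightarrow> shifts \<gamma>1 \<gamma>2 h x p (Suc q) = shifts \<gamma>1 \<gamma>2 h x p q @ [curve \<gamma>1 \<gamma>2 (x - real q * h)]"
  by (simp add: shifts_def)

text \<open>Induction on \<open>k\<close> with \<open>i\<close> and \<open>vs\<close> free, because
  level \<open>Suc k\<close> at index \<open>i\<close> calls level \<open>k\<close> at both
  \<open>i\<close> and \<open>Suc i\<close>. The vectors in \<open>vs\<close> may lie off the curve,
  since the coefficients of \<open>Qfun\<close> are determinants.\<close>

lemma Qfun_eq_blossom:
  assumes sym: "symmetric_args n g" and multi: "multilinear n g"
    and d: "\<And>i j. i \<le> j \<Longrightarrow> j < n \<Longrightarrow> dfun \<gamma>1 \<gamma>2 (a - real j * h) (b - real i * h) \<noteq> 0"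
    and "k + i \<le> n" and "length vs = k"
  shows "Qfun \<gamma>1 \<gamma>2 h n a b g k i vs =
           g (shifts \<gamma>1 \<gamma>2 h a (k + i) n @ shifts \<gamma>1 \<gamma>2 h b 0 i @ vs)"
  using assms(4,5)
proof (induction k arbitrary: i vs)
  case 0
  then show ?case by simp
next
  case (Suc k)
  obtain ws u where vs: "vs = ws @ [u]" and ws: "length ws = k"
    using Suc.prems(2) by (auto simp: length_Suc_conv_rev)
  define A where "A = curve \<gamma>1 \<gamma>2 (a - real (i + k) * h)"
  define B where "B = curve \<gamma>1 \<gamma>2 (b - real i * h)"
  \<comment> \<open>\<open>L\<close> collects the \<open>n - 1\<close> arguments shared by the three
    blossom values in this step; the remaining argument is \<open>A\<close> at index
    \<open>i\<close>, \<open>B\<close> at index \<open>Suc i\<close>, and \<open>u\<close> in the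
    result.\<close>
  define L where "L = shifts \<gamma>1 \<gamma>2 h a (Suc (k + i)) n @ shifts \<gamma>1 \<gamma>2 h b 0 i @ ws"
  have L: "length (x # L) = n" for x
    using Suc.prems(1) ws by (simp add: L_def)
  have perm: "g xs = g (x # L)" if "mset xs = mset (x # L)" for x xs
    using sym L that unfolding symmetric_args_def by blast
  have D: "dfun \<gamma>1 \<gamma>2 (a - real (i + k) * h) (b - real i * h) = det (vector [A, B] :: real^2^2)"
    by (simp only: dfun_eq_det A_def B_def)
  moreover have "dfun \<gamma>1 \<gamma>2 (a - real (i + k) * h) (b - real i * h) \<noteq> 0"
    \<comment> \<open>Here \<open>j\<close> is \<open>i + k\<close>, and
      \<open>Suc k + i \<le> n\<close> gives \<open>i + k < n\<close>.\<close>
    using Suc.prems(1) by (intro d) auto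
  ultimately have det: "det (vector [A, B] :: real^2^2) \<noteq> 0" by simp
  have lin: "linear (\<lambda>x. g (x # L))"
    using multi L by (intro multilinear_Cons[of "length L"]) auto
  have QA: "Qfun \<gamma>1 \<gamma>2 h n a b g k i ws = g (A # L)"
  proof -
    have "shifts \<gamma>1 \<gamma>2 h a (k + i) n = A # shifts \<gamma>1 \<gamma>2 h a (Suc (k + i)) n"
      using Suc.prems(1) by (simp add: shifts_Cons A_def add.commute)
    then show ?thesis
      using Suc.IH[of i ws] Suc.prems(1) ws by (simp add: L_def)
  qed
  \<comment> \<open>From \<open>i\<close> to \<open>Suc i\<close> the block at \<open>a\<close>
    loses its first entry \<open>A\<close>, while the block at \<open>b\<close> gains
    \<open>B\<close> at its end; symmetry moves \<open>B\<close> to the front.\<close>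
  have QB: "Qfun \<gamma>1 \<gamma>2 h n a b g k (Suc i) ws = g (B # L)"
    using Suc.IH[of "Suc i" ws] Suc.prems(1) ws
    by (simp add: shifts_snoc B_def[symmetric]) (rule perm, simp add: L_def)
  have "g (shifts \<gamma>1 \<gamma>2 h a (Suc k + i) n @ shifts \<gamma>1 \<gamma>2 h b 0 i @ vs) = g (u # L)"
    by (rule perm) (simp add: L_def vs)
  then show ?case
    \<comment> \<open>The coefficients given by Cramer's rule are exactly those in the definition of
      \<open>Qfun\<close>.\<close>
    using linear_cramer[OF lin det, of u]
    by (simp only: Qfun.simps vs last_snoc butlast_snoc QA QB D flip: A_def B_def)
qed

theorem theorem4p1:
  fixes n :: nat and h a b :: real
    and \<gamma>1 \<gamma>2 G :: "real \<Rightarrow> real"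
    and g :: "(real^2) list \<Rightarrow> real"
  assumes "n \<ge> 1"
    and "continuous_on UNIV \<gamma>1" and "continuous_on UNIV \<gamma>2"
    and "indep_functions (UNIV :: 2 set) (\<lambda>j t. curve \<gamma>1 \<gamma>2 t $ j)"
    and "translation_invariant \<gamma>1 \<gamma>2"
    and "indep_functions {0..n} (\<lambda>k. Gfun \<gamma>1 \<gamma>2 h n k)"
    and "\<And>i j. i \<le> j \<Longrightarrow> j \<le> n - 1 \<Longrightarrow> dfun \<gamma>1 \<gamma>2 (a - real j * h) (b - real i * h) \<noteq> 0"
    and "G \<in> pi_space n \<gamma>1 \<gamma>2"
    and "is_blossom \<gamma>1 \<gamma>2 h n G g"
  shows "(\<forall>k\<le>n. \<forall>i\<le>n - k. \<forall>us :: real list. length us = k \<longrightarrow>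
            Qfun \<gamma>1 \<gamma>2 h n a b g k i (map (curve \<gamma>1 \<gamma>2) us) =
            g (shifts \<gamma>1 \<gamma>2 h a (k + i) n @ shifts \<gamma>1 \<gamma>2 h b 0 i @ map (curve \<gamma>1 \<gamma>2) us))
       \<and> (\<forall>us :: real list. length us = n \<longrightarrow>
            Qfun \<gamma>1 \<gamma>2 h n a b g n 0 (map (curve \<gamma>1 \<gamma>2) us) = g (map (curve \<gamma>1 \<gamma>2) us))"
proof (intro conjI allI impI)
  have sym: "symmetric_args n g" and multi: "multilinear n g"
    using assms(9) by (auto simp: is_blossom_def)
  have d: "dfun \<gamma>1 \<gamma>2 (a - real j * h) (b - real i * h) \<noteq> 0" if "i \<le> j" "j < n" for i j
    using assms(7) that by simp
  note Q = Qfun_eq_blossom[OF sym multi d]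
  show "Qfun \<gamma>1 \<gamma>2 h n a b g k i (map (curve \<gamma>1 \<gamma>2) us) =
          g (shifts \<gamma>1 \<gamma>2 h a (k + i) n @ shifts \<gamma>1 \<gamma>2 h b 0 i @ map (curve \<gamma>1 \<gamma>2) us)"
    if "k \<le> n" "i \<le> n - k" "length us = k" for k i us
    using that by (intro Q) auto
  show "Qfun \<gamma>1 \<gamma>2 h n a b g n 0 (map (curve \<gamma>1 \<gamma>2) us) = g (map (curve \<gamma>1 \<gamma>2) us)"
    if "length us = n" for us
    \<comment> \<open>For \<open>k = n\<close> and \<open>i = 0\<close> both blocks of shifts are
      empty.\<close>
    using Q[of n 0 "map (curve \<gamma>1 \<gamma>2) us"] that by simp
qed

end
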